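(* Let $\alpha\in(0,1)$, $r\ge1$, $T,L,\varrho>0$, $f\in C([0,L]\times[0,T])$, $\varphi\in C[0,L]$. Let $K_t,K_x$ be positive integers, $t_n=T(n/K_t)^r$ for $0\le n\le K_t$, $h=L/K_x$, $x_i=ih$ for $0\le i\le K_x$, and $f_i^n=f(x_i,t_n)$. Then the finite difference scheme $$\frac{1}{\Gamma(2-\alpha)}\sum_{j=0}^{n}p_j^{(n)}u_i^{n-j}=\varrho\,\frac{u_{i+1}^n-2u_i^n+u_{i-1}^n}{h^2}+f_i^n,\qquad 1\le i\le K_x-1,\ 1\le n\le K_t,$$ $$u_0^n=0=u_{K_x}^n,\quad 0<n\le K_t,\qquad u_i^0=\varphi(x_i),\quad 0\le i\le K_x,$$ with the coefficients $p_j^{(n)}$ defined in the context, has a unique solution $(u_i^n)_{0\le i\le K_x,\,0\le n\le K_t}$.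
   Context: The coefficients $p_j^{(n)}$ ($0\le j\le n$, depending on $n$, $\alpha$ and the temporal mesh) are the real numbers determined by the identity, for all mesh functions $v$ with $v^m=v(t_m)$, $$\frac{1}{\Gamma(2-\alpha)}\sum_{j=0}^{n}p_j^{(n)}v^{n-j}=\frac{1}{\Gamma(1-\alpha)}\Big[\int_{t_0}^{t_1}(t_n-s)^{-\alpha}(I_{11}v)'(s)\,ds+\int_{t_1}^{t_2}(t_n-s)^{-\alpha}(I_{22}v)'(s)\,ds+\sum_{k=3}^{n}\int_{t_{k-1}}^{t_k}(t_n-s)^{-\alpha}(I_{3k}v)'(s)\,ds\Big],$$ where for $n=1$ only the first integral is present and for $n=2$ only the first two. Here $I_{11}v$ is the linear polynomial interpolating $v$ at $t_0,t_1$; $I_{22}v$ is the quadratic polynomial interpolating $v$ at $t_0,t_1,t_2$; and for $k\ge3$, $I_{3k}v$ is the cubic polynomial interpolating $v$ at $t_{k-3},t_{k-2},t_{k-1},t_k$. The scheme discretizes the problem ${}_CD_{0,t}^{\alpha}u-\varrho\,\partial_x^2u=f$ on $0<x<L$, $0<t\le T$, with $u(0,t)=u(L,t)=0$ and $u(x,0)=\varphi(x)$, where ${}_CD_{0,t}^\alpha$ is the Caputo derivative of order $\alpha$ in time. *)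

theory Defs
  imports "HOL-Analysis.Analysis" "HOL-Computational_Algebra.Polynomial"
begin

definition interp_poly :: "nat set \<Rightarrow> (nat \<Rightarrow> real) \<Rightarrow> (nat \<Rightarrow> real) \<Rightarrow> real poly" where
  "interp_poly J t v = (THE q. degree q < card J \<and> (\<forall>j\<in>J. poly q (t j) = v j))"

(* Subtraction on nat truncates, so {k-3..k} is {0,1} for k = 1, {0,1,2} for k = 2 and
   {k-3,k-2,k-1,k} for k \<ge> 3: the interpolant is linear on the first subinterval, quadratic
   on the second and cubic on all later ones.  At s = t n the kernel takes the value
   0 powr (-\<alpha>) = 0, which does not affect the integral. *)
definition discrete_caputo :: "real \<Rightarrow> (nat \<Rightarrow> real) \<Rightarrow> (nat \<Rightarrow> real) \<Rightarrow> nat \<Rightarrow> real" where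
  "discrete_caputo \<alpha> t v n = 1 / Gamma (1 - \<alpha>) *
     (\<Sum>k=1..n. integral {t (k - 1)..t k}
        (\<lambda>s. (t n - s) powr (- \<alpha>) * poly (pderiv (interp_poly {k - 3..k} t v)) s))"

(* The description is proper for every strictly increasing mesh, see ex1_caputo_coeffs below. *)
definition caputo_coeffs :: "real \<Rightarrow> (nat \<Rightarrow> real) \<Rightarrow> nat \<Rightarrow> nat \<Rightarrow> real" where
  "caputo_coeffs \<alpha> t n = (THE p. p \<in> extensional {0..n} \<and>
     (\<forall>v. 1 / Gamma (2 - \<alpha>) * (\<Sum>j=0..n. p j * v (n - j)) = discrete_caputo \<alpha> t v n))"

definition graded_mesh :: "real \<Rightarrow> nat \<Rightarrow> real \<Rightarrow> nat \<Rightarrow> real" where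
  "graded_mesh T Kt r n = T * (real n / real Kt) powr r"

(* u (i, n) is the value at the spatial node x i and the time level t n. *)
definition fd_scheme :: "real \<Rightarrow> real \<Rightarrow> real \<Rightarrow> real \<Rightarrow> real \<Rightarrow> nat \<Rightarrow> nat \<Rightarrow>
    (real \<times> real \<Rightarrow> real) \<Rightarrow> (real \<Rightarrow> real) \<Rightarrow> (nat \<times> nat \<Rightarrow> real) \<Rightarrow> bool" where
  "fd_scheme \<alpha> r T L \<rho> Kt Kx f \<phi> u \<longleftrightarrow>
    (let t = graded_mesh T Kt r; h = L / real Kx; x = (\<lambda>i. real i * h) in
      (\<forall>i\<in>{1..<Kx}. \<forall>n\<in>{1..Kt}.
         1 / Gamma (2 - \<alpha>) * (\<Sum>j=0..n. caputo_coeffs \<alpha> t n j * u (i, n - j)) =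
         \<rho> * ((u (i + 1, n) - 2 * u (i, n) + u (i - 1, n)) / h\<^sup>2) + f (x i, t n)) \<and>
      (\<forall>n\<in>{1..Kt}. u (0, n) = 0 \<and> u (Kx, n) = 0) \<and>
      (\<forall>i\<in>{0..Kx}. u (i, 0) = \<phi> (x i)))"


definition lagrange_basis :: "nat set \<Rightarrow> (nat \<Rightarrow> real) \<Rightarrow> nat \<Rightarrow> real poly" where
  "lagrange_basis J t j = (\<Prod>i\<in>J - {j}. smult (1 / (t j - t i)) [:- t i, 1:])"

lemma degree_lagrange_basis:
  assumes "finite J" "j \<in> J"
  shows "degree (lagrange_basis J t j) < card J"
proof -
  have "degree (lagrange_basis J t j) \<le>
      (\<Sum>i\<in>J - {j}. degree (smult (1 / (t j - t i)) [:- t i, 1:]))"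
    unfolding lagrange_basis_def using assms by (intro order.trans[OF degree_prod_sum_le]) auto
  also have "\<dots> \<le> (\<Sum>i\<in>J - {j}. 1)"
    by (intro sum_mono) auto
  also have "\<dots> < card J"
    using card_Diff1_less[OF assms] by simp
  finally show ?thesis .
qed

lemma poly_lagrange_basis:
  assumes "finite J" "inj_on t J" "j \<in> J" "i \<in> J"
  shows "poly (lagrange_basis J t j) (t i) = (if i = j then 1 else 0)"
proof (cases "i = j")
  case True
  have "poly (lagrange_basis J t j) (t j) = (\<Prod>m\<in>J - {j}. 1)"
    unfolding lagrange_basis_def poly_prod using assms
    by (intro prod.cong) (auto simp: inj_on_def diff_divide_distrib[symmetric])
  then show ?thesis
    using True by simp
next
  case False
  then show ?thesis
    using assms by (auto simp: lagrange_basis_def poly_prod)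
qed

lemma interp_poly_unique:
  fixes q q' :: "real poly"
  assumes J: "finite J" and t: "inj_on t J"
    and q: "degree q < card J" "\<forall>j\<in>J. poly q (t j) = v j"
    and q': "degree q' < card J" "\<forall>j\<in>J. poly q' (t j) = v j"
  shows "q = q'"
proof (rule ccontr)
  assume "q \<noteq> q'"
  then have nz: "q - q' \<noteq> 0" by simp
  have "card J = card (t ` J)" using t by (simp add: card_image)
  also have "\<dots> \<le> card {x. poly (q - q') x = 0}"
    using q(2) q'(2) poly_roots_finite[OF nz] by (intro card_mono) auto
  also have "\<dots> \<le> degree (q - q')" using nz by (rule card_poly_roots_bound)
  also have "\<dots> < card J" using q(1) q'(1) by (rule degree_diff_less)
  finally show False by simp
qed

lemma interp_poly_eq:
  assumes J: "finite J" "J \<noteq> {}" and t: "inj_on t J"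
  shows "interp_poly J t v = (\<Sum>j\<in>J. smult (v j) (lagrange_basis J t j))" (is "_ = ?q")
proof -
  have d: "degree ?q < card J"
  proof (rule degree_sum_less)
    show "0 < card J" using J by (simp add: card_gt_0_iff)
    show "degree (smult (v j) (lagrange_basis J t j)) < card J" if "j \<in> J" for j
      using degree_lagrange_basis[OF J(1) that, of t] by auto
  qed
  have i: "\<forall>i\<in>J. poly ?q (t i) = v i"
  proof
    fix i assume i: "i \<in> J"
    have "poly ?q (t i) = (\<Sum>j\<in>J. if i = j then v j else 0)"
      unfolding poly_sum using i by (intro sum.cong) (auto simp: poly_lagrange_basis[OF J(1) t])
    then show "poly ?q (t i) = v i" using J i by simp
  qed
  show ?thesis
    unfolding interp_poly_def using d i interp_poly_unique[OF J(1) t] by (intro the_equality) blast+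
qed

lemma kernel_integrable:
  fixes a b c \<alpha> :: real
  assumes "0 < \<alpha>" "\<alpha> < 1" "b \<le> c"
  shows "(\<lambda>s. (c - s) powr (- \<alpha>) * poly q s) integrable_on {a..b}"
proof -
  have "(\<lambda>s. (c - s) powr (- \<alpha>)) integrable_on {a..c}"
  proof (cases "a \<le> c")
    case True
    have "((\<lambda>x. x powr (- \<alpha>)) has_integral ((c - a) powr (- \<alpha> + 1) / (- \<alpha> + 1))) {0..c - a}"
      using assms True by (intro has_integral_powr_from_0) auto
    then have "(\<lambda>x. x powr (- \<alpha>)) integrable_on (cbox 0 (c - a))" by auto
    from integrable_affinity[OF this, of "-1" c] have
      "(\<lambda>s. (c - s) powr (- \<alpha>)) integrable_on (\<lambda>x. c - x) ` {0..c - a}" by (simp add: algebra_simps)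
    moreover have "(\<lambda>x. c - x) ` {0..c - a} = {a..c}" by simp
    ultimately show ?thesis by simp
  qed auto
  then have "(\<lambda>s. (c - s) powr (- \<alpha>)) integrable_on {a..b}"
    using assms by (elim integrable_on_subinterval) auto
  then have "(\<lambda>s. (c - s) powr (- \<alpha>)) absolutely_integrable_on {a..b}"
    by (intro nonnegative_absolutely_integrable_1) auto
  moreover have "continuous_on {a..b} (poly q)" by (intro continuous_intros)
  ultimately have "(\<lambda>s. poly q s * (c - s) powr (- \<alpha>)) absolutely_integrable_on {a..b}"
    by (intro absolutely_integrable_bounded_measurable_product_real)
      (auto intro: continuous_imp_measurable_on_sets_lebesgue compact_imp_bounded compact_continuous_image)
  then show ?thesis
    by (simp add: absolutely_integrable_on_def mult.commute)
qed

lemma pderiv_sum: "pderiv (\<Sum>j\<in>J. f j) = (\<Sum>j\<in>J. pderiv (f j))"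
  by (induction J rule: infinite_finite_induct) (auto simp: pderiv_add)

lemma discrete_caputo_linear:
  assumes \<alpha>: "0 < \<alpha>" "\<alpha> < 1" and t: "strict_mono_on {0..n} t"
  shows "discrete_caputo \<alpha> t v n =
    (\<Sum>m=0..n. v m * discrete_caputo \<alpha> t (\<lambda>i. if i = m then 1 else 0) n)"
proof -
  define W where "W k m = (if m \<in> {k - 3..k} then integral {t (k - 1)..t k}
    (\<lambda>s. (t n - s) powr (- \<alpha>) * poly (pderiv (lagrange_basis {k - 3..k} t m)) s) else 0)" for k m
  have piece: "integral {t (k - 1)..t k}
      (\<lambda>s. (t n - s) powr (- \<alpha>) * poly (pderiv (interp_poly {k - 3..k} t w)) s) =
      (\<Sum>m=0..n. w m * W k m)" if k: "k \<in> {1..n}" for k w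
  proof -
    have inj: "inj_on t {k - 3..k}"
      using strict_mono_on_imp_inj_on[OF t] by (rule inj_on_subset) (use k in auto)
    have le: "t k \<le> t n"
      using strict_mono_on_leD[OF t, of k n] k by auto
    have "integral {t (k - 1)..t k}
        (\<lambda>s. (t n - s) powr (- \<alpha>) * poly (pderiv (interp_poly {k - 3..k} t w)) s) =
      integral {t (k - 1)..t k} (\<lambda>s. \<Sum>m\<in>{k - 3..k}. w m *
        ((t n - s) powr (- \<alpha>) * poly (pderiv (lagrange_basis {k - 3..k} t m)) s))"
      by (subst interp_poly_eq[OF _ _ inj])
        (auto simp: pderiv_sum pderiv_smult poly_sum sum_distrib_left mult_ac)
    also have "\<dots> = (\<Sum>m\<in>{k - 3..k}. integral {t (k - 1)..t k} (\<lambda>s. w m *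
        ((t n - s) powr (- \<alpha>) * poly (pderiv (lagrange_basis {k - 3..k} t m)) s)))"
      by (intro integral_sum integrable_on_mult_right kernel_integrable \<alpha> le) auto
    also have "\<dots> = (\<Sum>m\<in>{k - 3..k}. w m * W k m)"
      by (intro sum.cong) (auto simp: W_def)
    also have "\<dots> = (\<Sum>m=0..n. w m * W k m)"
      using k by (intro sum.mono_neutral_left) (auto simp: W_def)
    finally show ?thesis .
  qed
  have D: "discrete_caputo \<alpha> t w n =
      (\<Sum>m=0..n. w m * (1 / Gamma (1 - \<alpha>) * (\<Sum>k=1..n. W k m)))" for w
  proof -
    have "discrete_caputo \<alpha> t w n = 1 / Gamma (1 - \<alpha>) * (\<Sum>k=1..n. \<Sum>m=0..n. w m * W k m)"
      unfolding discrete_caputo_def by (intro arg_cong2[of _ _ _ _ "(*)"] refl sum.cong piece)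
    also have "\<dots> = 1 / Gamma (1 - \<alpha>) * (\<Sum>m=0..n. w m * (\<Sum>k=1..n. W k m))"
      unfolding sum_distrib_left[of "w _"] by (subst sum.swap) (rule refl)
    also have "\<dots> = (\<Sum>m=0..n. w m * (1 / Gamma (1 - \<alpha>) * (\<Sum>k=1..n. W k m)))"
      unfolding sum_distrib_left[of "1 / Gamma _" _ "{0..n}"]
      by (intro sum.cong refl) (rule mult.left_commute)
    finally show ?thesis .
  qed
  have unit: "discrete_caputo \<alpha> t (\<lambda>i. if i = m then 1 else 0) n =
      1 / Gamma (1 - \<alpha>) * (\<Sum>k=1..n. W k m)" if "m \<in> {0..n}" for m
  proof -
    have "discrete_caputo \<alpha> t (\<lambda>i. if i = m then 1 else 0) n =
        (\<Sum>i=0..n. if i = m then 1 / Gamma (1 - \<alpha>) * (\<Sum>k=1..n. W k i) else 0)"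
      unfolding D by (intro sum.cong) auto
    then show ?thesis using that by simp
  qed
  show ?thesis
    unfolding D[of v] by (intro sum.cong refl arg_cong2[of _ _ _ _ "(*)"] unit[symmetric])
qed

lemma ex1_caputo_coeffs:
  assumes \<alpha>: "0 < \<alpha>" "\<alpha> < 1" and t: "strict_mono_on {0..n} t"
  shows "\<exists>!p. p \<in> extensional {0..n} \<and>
     (\<forall>v. 1 / Gamma (2 - \<alpha>) * (\<Sum>j=0..n. p j * v (n - j)) = discrete_caputo \<alpha> t v n)"
proof (rule ex_ex1I)
  have G: "Gamma (2 - \<alpha>) \<noteq> 0" using \<alpha> Gamma_real_pos[of "2 - \<alpha>"] by linarith
  let ?D = "\<lambda>m. discrete_caputo \<alpha> t (\<lambda>i. if i = m then 1 else 0) n"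
  let ?p = "restrict (\<lambda>j. Gamma (2 - \<alpha>) * ?D (n - j)) {0..n}"
  have "1 / Gamma (2 - \<alpha>) * (\<Sum>j=0..n. ?p j * v (n - j)) = discrete_caputo \<alpha> t v n" for v
  proof -
    have "1 / Gamma (2 - \<alpha>) * (\<Sum>j=0..n. ?p j * v (n - j)) = (\<Sum>j=0..n. v (n - j) * ?D (n - j))"
      using G by (simp add: sum_distrib_left mult_ac)
    also have "\<dots> = (\<Sum>m=0..n. v m * ?D m)"
      by (rule sum.reindex_bij_witness[of _ "\<lambda>m. n - m" "\<lambda>m. n - m"]) auto
    finally show ?thesis using discrete_caputo_linear[OF \<alpha> t, of v] by simp
  qed
  then show "\<exists>p. p \<in> extensional {0..n} \<and>
     (\<forall>v. 1 / Gamma (2 - \<alpha>) * (\<Sum>j=0..n. p j * v (n - j)) = discrete_caputo \<alpha> t v n)"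
    by (intro exI[of _ ?p]) auto
next
  fix p q
  assume p: "p \<in> extensional {0..n} \<and>
     (\<forall>v. 1 / Gamma (2 - \<alpha>) * (\<Sum>j=0..n. p j * v (n - j)) = discrete_caputo \<alpha> t v n)"
    and q: "q \<in> extensional {0..n} \<and>
     (\<forall>v. 1 / Gamma (2 - \<alpha>) * (\<Sum>j=0..n. q j * v (n - j)) = discrete_caputo \<alpha> t v n)"
  have G: "Gamma (2 - \<alpha>) \<noteq> 0" using \<alpha> Gamma_real_pos[of "2 - \<alpha>"] by linarith
  show "p = q"
  proof (rule extensionalityI)
    show "p \<in> extensional {0..n}" "q \<in> extensional {0..n}" using p q by auto
    fix i assume i: "i \<in> {0..n}"
    let ?v = "\<lambda>m. if m = n - i then 1 else 0 :: real"
    have sel: "(\<Sum>j=0..n. w j * ?v (n - j)) = w i" for w :: "nat \<Rightarrow> real"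
    proof -
      have "(\<Sum>j=0..n. w j * ?v (n - j)) = (\<Sum>j=0..n. if j = i then w j else 0)"
        using i by (intro sum.cong) auto
      then show ?thesis using i by simp
    qed
    have "1 / Gamma (2 - \<alpha>) * (\<Sum>j=0..n. p j * ?v (n - j)) =
        1 / Gamma (2 - \<alpha>) * (\<Sum>j=0..n. q j * ?v (n - j))"
      by (rule trans[OF spec[OF conjunct2[OF p]] spec[OF conjunct2[OF q], symmetric]])
    then show "p i = q i" unfolding sel using G by simp
  qed
qed

lemma caputo_coeffs_identity:
  assumes "0 < \<alpha>" "\<alpha> < 1" "strict_mono_on {0..n} t"
  shows "1 / Gamma (2 - \<alpha>) * (\<Sum>j=0..n. caputo_coeffs \<alpha> t n j * v (n - j)) =
    discrete_caputo \<alpha> t v n"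
  using theI'[OF ex1_caputo_coeffs[OF assms]] unfolding caputo_coeffs_def by blast

lemma strict_mono_graded_mesh:
  assumes "0 < T" "0 < Kt" "0 < r"
  shows "strict_mono (graded_mesh T Kt r)"
proof (rule strict_monoI)
  fix m n :: nat
  assume "m < n"
  then have "real m / real Kt < real n / real Kt"
    using assms by (intro divide_strict_right_mono) auto
  then have "(real m / real Kt) powr r < (real n / real Kt) powr r"
    using assms by (intro powr_less_mono2) auto
  then show "graded_mesh T Kt r m < graded_mesh T Kt r n"
    using assms by (simp add: graded_mesh_def)
qed

end

theory Submission
  imports Defs
begin

text \<open>
  Only the last subinterval sees the value \<open>v\<^sup>n\<close>, and the derivative of the Lagrange basis polynomial
  of the rightmost node is nonnegative to the right of the other nodes; hence the leading
  coefficient is nonnegative. Each time level is then a tridiagonal boundary value problem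
  \<open>w\<^bsub>i+1\<^esub> = \<beta> w\<^sub>i - w\<^bsub>i-1\<^esub> - g\<^sub>i\<close> with \<open>\<beta> \<ge> 2\<close>, solved by shooting from the left boundary: the endpoint
  is an affine function of the initial slope, whose linear coefficient is positive because the
  homogeneous solution with values \<open>0, 1\<close> is strictly increasing. March through the time levels.
\<close>

section \<open>Shooting for the tridiagonal boundary value problem\<close>

text \<open>The source is indexed by the middle node of each stencil, so \<open>g 0\<close> never
  enters; \<open>s\<close> is the free value at the first interior node.\<close>

fun shoot :: "real \<Rightarrow> (nat \<Rightarrow> real) \<Rightarrow> real \<Rightarrow> nat \<Rightarrow> real" where
  "shoot \<beta> g s 0 = 0"
| "shoot \<beta> g s (Suc 0) = s"
| "shoot \<beta> g s (Suc (Suc i)) = \<beta> * shoot \<beta> g s (Suc i) - shoot \<beta> g s i - g (Suc i)"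

text \<open>Superposition: hitting a prescribed right boundary value becomes one linear equation in
  \<open>s\<close>.\<close>

lemma shoot_affine: "shoot \<beta> g s i = s * shoot \<beta> (\<lambda>_. 0) 1 i + shoot \<beta> g 0 i"
  by (induction \<beta> g s i rule: shoot.induct) (simp_all add: algebra_simps)

text \<open>Because \<beta> is at least 2, each increment is at least the previous one, and the
  first is 1. Nonnegativity is carried along to multiply the bound on \<beta> by the current
  value.\<close>

lemma shoot_homogeneous_increasing:
  assumes "2 \<le> \<beta>"
  shows "0 \<le> shoot \<beta> (\<lambda>_. 0) 1 i \<and> shoot \<beta> (\<lambda>_. 0) 1 i < shoot \<beta> (\<lambda>_. 0) 1 (Suc i)"
proof (induction i)
  case (Suc i)
  let ?a = "shoot \<beta> (\<lambda>_. 0) 1"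
  have "2 * ?a (Suc i) \<le> \<beta> * ?a (Suc i)"
    using assms Suc by (intro mult_right_mono) auto
  then show ?case using Suc unfolding shoot.simps by linarith
qed simp

lemma shoot_homogeneous_pos:
  assumes "2 \<le> \<beta>" "0 < i"
  shows "0 < shoot \<beta> (\<lambda>_. 0) 1 i"
  using shoot_homogeneous_increasing[OF assms(1), of "i - 1"] assms(2) by simp

text \<open>A second-order recurrence is determined by its first two values; it holds only inside
  the grid, hence the bound \<open>i \<le> K\<close>.\<close>

lemma eq_shoot:
  assumes "w 0 = 0" and "w 1 = s"
    and "\<And>i. Suc i < K \<Longrightarrow> w (Suc (Suc i)) = \<beta> * w (Suc i) - w i - g (Suc i)"
    and "i \<le> K"
  shows "w i = shoot \<beta> g s i"
  using assms(4)
proof (induction i rule: less_induct)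
  case (less i)
  consider "i = 0" | "i = Suc 0" | k where "i = Suc (Suc k)"
    by (metis not0_implies_Suc)
  then show ?case
  proof cases
    case (3 k)
    then show ?thesis using less assms(3)[of k] by simp
  qed (use assms(1,2) in auto)
qed

text \<open>Dividing by \<open>d\<close> and solving for the right neighbour gives the shooting form
  with \<beta> equal to \<open>2 + c / d\<close>, which is at least 2 once \<open>c\<close> is
  nonnegative.\<close>

lemma second_difference_recurrence:
  fixes c d :: real and g :: "nat \<Rightarrow> real"
  assumes "0 < d"
  shows "(\<forall>i\<in>{1..<K}. c * w i = d * (w (i + 1) - 2 * w i + w (i - 1)) + g i) \<longleftrightarrow>
    (\<forall>i. Suc i < K \<longrightarrow> w (Suc (Suc i)) = (2 + c / d) * w (Suc i) - w i - g (Suc i) / d)"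
proof -
  have pointwise: "c * w (Suc i) = d * (w (Suc (Suc i)) - 2 * w (Suc i) + w i) + g (Suc i) \<longleftrightarrow>
    w (Suc (Suc i)) = (2 + c / d) * w (Suc i) - w i - g (Suc i) / d" for i
  proof -
    have expand: "d * ((2 + c / d) * w (Suc i) - w i - g (Suc i) / d) =
        d * (2 * w (Suc i) - w i) + c * w (Suc i) - g (Suc i)"
      using assms by (simp add: field_simps)
    have cancel: "w (Suc (Suc i)) = (2 + c / d) * w (Suc i) - w i - g (Suc i) / d \<longleftrightarrow>
        d * w (Suc (Suc i)) = d * ((2 + c / d) * w (Suc i) - w i - g (Suc i) / d)"
      using assms by simp
    show ?thesis
      \<comment> \<open>Once distributed, products such as \<open>d * w i\<close> are atoms and the
        equivalence is linear.\<close>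
      unfolding cancel expand unfolding right_diff_distrib distrib_left by (intro iffI) linarith+
  qed
  have shift: "(\<forall>i\<in>{1..<K}. P i) \<longleftrightarrow> (\<forall>i. Suc i < K \<longrightarrow> P (Suc i))" for P :: "nat \<Rightarrow> bool"
  proof (intro iffI ballI)
    fix i assume "\<forall>i. Suc i < K \<longrightarrow> P (Suc i)" "i \<in> {1..<K}"
    then show "P i" by (cases i) auto
  qed auto
  show ?thesis
    unfolding shift pointwise[symmetric] by simp
qed

lemma second_difference_bvp_exists:
  fixes c d :: real and g :: "nat \<Rightarrow> real"
  assumes "0 \<le> c" "0 < d" "0 < K"
  shows "\<exists>w. w 0 = 0 \<and> w K = 0 \<and>
    (\<forall>i\<in>{1..<K}. c * w i = d * (w (i + 1) - 2 * w i + w (i - 1)) + g i)"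
proof -
  define \<beta> where "\<beta> = 2 + c / d"
  \<comment> \<open>The root of the affine map sending the slope to the value at
    \<open>K\<close>.\<close>
  define s where "s = - shoot \<beta> (\<lambda>i. g i / d) 0 K / shoot \<beta> (\<lambda>_. 0) 1 K"
  have "0 < shoot \<beta> (\<lambda>_. 0) 1 K"
    using assms by (intro shoot_homogeneous_pos) (auto simp: \<beta>_def)
  then have "shoot \<beta> (\<lambda>i. g i / d) s K = 0"
    by (subst shoot_affine) (simp add: s_def)
  then show ?thesis
    unfolding second_difference_recurrence[OF assms(2)]
    by (intro exI[of _ "shoot \<beta> (\<lambda>i. g i / d) s"]) (simp add: \<beta>_def)
qed

lemma second_difference_bvp_unique:
  fixes c d :: real and g :: "nat \<Rightarrow> real"
  assumes "0 \<le> c" "0 < d" "0 < K"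
    and w: "w 0 = 0" "w K = 0"
      "\<forall>i\<in>{1..<K}. c * w i = d * (w (i + 1) - 2 * w i + w (i - 1)) + g i"
    and w': "w' 0 = 0" "w' K = 0"
      "\<forall>i\<in>{1..<K}. c * w' i = d * (w' (i + 1) - 2 * w' i + w' (i - 1)) + g i"
    and "i \<le> K"
  shows "w i = w' i"
proof -
  define \<beta> where "\<beta> = 2 + c / d"
  have pos: "0 < shoot \<beta> (\<lambda>_. 0) 1 K"
    using assms(1-3) by (intro shoot_homogeneous_pos) (auto simp: \<beta>_def)
  have e: "w i = shoot \<beta> (\<lambda>i. g i / d) (w 1) i" if "i \<le> K" for i
    using w(1,3) that unfolding second_difference_recurrence[OF assms(2)] \<beta>_def
    by (intro eq_shoot) auto
  have e': "w' i = shoot \<beta> (\<lambda>i. g i / d) (w' 1) i" if "i \<le> K" for i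
    using w'(1,3) that unfolding second_difference_recurrence[OF assms(2)] \<beta>_def
    by (intro eq_shoot) auto
  \<comment> \<open>Both solutions end at zero; the particular parts cancel and the positive linear
    coefficient forces equal slopes.\<close>
  have "shoot \<beta> (\<lambda>i. g i / d) (w 1) K = shoot \<beta> (\<lambda>i. g i / d) (w' 1) K"
    using e[of K] e'[of K] w(2) w'(2) by simp
  then have "w 1 = w' 1"
    using pos unfolding shoot_affine[of \<beta> _ "w 1"] shoot_affine[of \<beta> _ "w' 1"] by simp
  then show ?thesis using e e' \<open>i \<le> K\<close> by simp
qed

section \<open>Marching through the time levels\<close>

text \<open>In the newest level only \<open>q n 0\<close> multiplies unknowns; all other terms of
  the sum are history and join the source, leaving one boundary value problem per level.\<close>

lemma implicit_scheme_exists: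
  fixes q :: "nat \<Rightarrow> nat \<Rightarrow> real" and K :: nat
  assumes "\<And>n. n \<in> {1..N} \<Longrightarrow> 0 \<le> q n 0" "0 < d" "0 < K"
  shows "\<exists>u. (\<forall>i\<in>{1..<K}. \<forall>n\<in>{1..N}. (\<Sum>j=0..n. q n j * u (i, n - j)) =
        d * (u (i + 1, n) - 2 * u (i, n) + u (i - 1, n)) + F i n) \<and>
      (\<forall>n\<in>{1..N}. u (0, n) = 0 \<and> u (K, n) = 0) \<and> (\<forall>i\<in>{0..K}. u (i, 0) = g i)"
  using assms(1)
proof (induction N)
  case 0
  \<comment> \<open>Without time steps only the initial condition remains.\<close>
  show ?case by (rule exI[of _ "\<lambda>(i, n). g i"]) simp
next
  case (Suc N)
  then have "\<And>n. n \<in> {1..N} \<Longrightarrow> 0 \<le> q n 0" by simp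
  then obtain u where
    u: "\<forall>i\<in>{1..<K}. \<forall>n\<in>{1..N}. (\<Sum>j=0..n. q n j * u (i, n - j)) =
          d * (u (i + 1, n) - 2 * u (i, n) + u (i - 1, n)) + F i n"
      "\<forall>n\<in>{1..N}. u (0, n) = 0 \<and> u (K, n) = 0" "\<forall>i\<in>{0..K}. u (i, 0) = g i"
    using Suc.IH by blast
  define S where "S i = (\<Sum>j=1..Suc N. q (Suc N) j * u (i, Suc N - j))" for i
  obtain w where w: "w 0 = 0" "w K = 0"
    "\<forall>i\<in>{1..<K}. q (Suc N) 0 * w i =
      d * (w (i + 1) - 2 * w i + w (i - 1)) + (F i (Suc N) - S i)"
  proof -
    have "0 \<le> q (Suc N) 0" using Suc.prems by simp
    from second_difference_bvp_exists[OF this assms(2,3), of "\<lambda>i. F i (Suc N) - S i"]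
    show ?thesis by (elim exE conjE) (rule that)
  qed
  define u' where "u' = (\<lambda>(i, n). if n = Suc N then w i else u (i, n))"
  have old: "u' (i, n) = u (i, n)" if "n \<le> N" for i n
    using that by (simp add: u'_def)
  have "(\<Sum>j=0..n. q n j * u' (i, n - j)) =
      d * (u' (i + 1, n) - 2 * u' (i, n) + u' (i - 1, n)) + F i n"
    if i: "i \<in> {1..<K}" and n: "n \<in> {1..Suc N}" for i n
  proof (cases "n = Suc N")
    case True
    have "(\<Sum>j=0..n. q n j * u' (i, n - j)) =
        q n 0 * u' (i, n) + (\<Sum>j=1..n. q n j * u' (i, n - j))"
      by (simp add: sum.atLeast_Suc_atMost)
    \<comment> \<open>For \<open>j \<ge> 1\<close> the sum reads levels up to \<open>N\<close> only,
      where \<open>u'\<close> agrees with \<open>u\<close>.\<close>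
    also have "(\<Sum>j=1..n. q n j * u' (i, n - j)) = S i"
      unfolding S_def True by (intro sum.cong refl arg_cong2[of _ _ _ _ "(*)"] old) auto
    finally show ?thesis
      using bspec[OF w(3) i] True by (simp add: u'_def)
  next
    case False
    then have "n \<le> N" using n by simp
    moreover from this have "(\<Sum>j=0..n. q n j * u' (i, n - j)) = (\<Sum>j=0..n. q n j * u (i, n - j))"
      by (intro sum.cong refl) (simp add: old)
    moreover have "(\<Sum>j=0..n. q n j * u (i, n - j)) =
        d * (u (i + 1, n) - 2 * u (i, n) + u (i - 1, n)) + F i n"
      using u(1) i \<open>n \<le> N\<close> n by simp
    ultimately show ?thesis by (simp only: old)
  qed
  moreover have "u' (0, n) = 0 \<and> u' (K, n) = 0" if "n \<in> {1..Suc N}" for n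
    using that u(2) w(1,2) by (cases "n = Suc N") (auto simp: u'_def)
  moreover have "\<forall>i\<in>{0..K}. u' (i, 0) = g i"
    using u(3) by (simp add: old)
  ultimately show ?case by blast
qed

text \<open>Strong induction on the level, since the history reaches back to all earlier levels:
  equal histories leave both solutions with the same boundary value problem.\<close>

lemma implicit_scheme_unique:
  fixes q :: "nat \<Rightarrow> nat \<Rightarrow> real" and u u' :: "nat \<times> nat \<Rightarrow> real"
  assumes q: "\<And>n. n \<in> {1..N} \<Longrightarrow> 0 \<le> q n 0" and "0 < d" "0 < K"
    and u: "\<forall>i\<in>{1..<K}. \<forall>n\<in>{1..N}. (\<Sum>j=0..n. q n j * u (i, n - j)) =
        d * (u (i + 1, n) - 2 * u (i, n) + u (i - 1, n)) + F i n"
      "\<forall>n\<in>{1..N}. u (0, n) = 0 \<and> u (K, n) = 0" "\<forall>i\<in>{0..K}. u (i, 0) = g i"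
    and u': "\<forall>i\<in>{1..<K}. \<forall>n\<in>{1..N}. (\<Sum>j=0..n. q n j * u' (i, n - j)) =
        d * (u' (i + 1, n) - 2 * u' (i, n) + u' (i - 1, n)) + F i n"
      "\<forall>n\<in>{1..N}. u' (0, n) = 0 \<and> u' (K, n) = 0" "\<forall>i\<in>{0..K}. u' (i, 0) = g i"
    and "i \<le> K" "n \<le> N"
  shows "u (i, n) = u' (i, n)"
  using \<open>i \<le> K\<close> \<open>n \<le> N\<close>
proof (induction n arbitrary: i rule: less_induct)
  case (less n)
  show ?case
  proof (cases "n = 0")
    case True
    then show ?thesis using u(3) u'(3) less.prems by simp
  next
    case False
    then have n: "n \<in> {1..N}" using less.prems by simp
    define S where "S i = (\<Sum>j=1..n. q n j * u (i, n - j))" for i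
    have split: "(\<Sum>j=0..n. q n j * v (k, n - j)) =
        q n 0 * v (k, n) + (\<Sum>j=1..n. q n j * v (k, n - j))" for k and v :: "nat \<times> nat \<Rightarrow> real"
      by (simp add: sum.atLeast_Suc_atMost)
    have S': "(\<Sum>j=1..n. q n j * u' (k, n - j)) = S k" if "k \<le> K" for k
      unfolding S_def using that less.prems n
      by (intro sum.cong refl arg_cong2[of _ _ _ _ "(*)"] less.IH[symmetric]) auto
    have eq: "q n 0 * u (k, n) = d * (u (k + 1, n) - 2 * u (k, n) + u (k - 1, n)) + (F k n - S k)"
      if "k \<in> {1..<K}" for k
    proof -
      have "q n 0 * u (k, n) + S k = d * (u (k + 1, n) - 2 * u (k, n) + u (k - 1, n)) + F k n"
        unfolding S_def split[symmetric] using that n u(1) by blast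
      then show ?thesis by linarith
    qed
    have eq':
      "q n 0 * u' (k, n) = d * (u' (k + 1, n) - 2 * u' (k, n) + u' (k - 1, n)) + (F k n - S k)"
      if "k \<in> {1..<K}" for k
    proof -
      have "k \<le> K" using that by simp
      have "q n 0 * u' (k, n) + S k = d * (u' (k + 1, n) - 2 * u' (k, n) + u' (k - 1, n)) + F k n"
        unfolding S'[OF \<open>k \<le> K\<close>, symmetric] split[symmetric] using that n u'(1) by blast
      then show ?thesis by linarith
    qed
    show ?thesis
      by (rule second_difference_bvp_unique[where w = "\<lambda>i. u (i, n)" and w' = "\<lambda>i. u' (i, n)"
            and c = "q n 0" and g = "\<lambda>i. F i n - S i" and d = d and K = K])
        (use eq eq' n u(2) u'(2) less.prems(1) q[OF n] assms(2,3) in blast)+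
  qed
qed

section \<open>Sign of the leading coefficient\<close>

text \<open>In the product rule each summand is the derivative of one factor times values of the
  others.\<close>

lemma poly_pderiv_prod_nonneg:
  fixes p :: "'a \<Rightarrow> real poly"
  assumes "\<And>i. i \<in> I \<Longrightarrow> 0 \<le> poly (p i) s" "\<And>i. i \<in> I \<Longrightarrow> 0 \<le> poly (pderiv (p i)) s"
  shows "0 \<le> poly (pderiv (\<Prod>i\<in>I. p i)) s"
  unfolding pderiv_prod poly_sum poly_mult poly_prod
  using assms by (intro sum_nonneg mult_nonneg_nonneg prod_nonneg) auto

text \<open>Each linear factor has positive slope and its root is not to the right of
  \<open>s\<close>.\<close>

lemma pderiv_lagrange_basis_nonneg:
  assumes "\<And>i. i \<in> J - {j} \<Longrightarrow> t i < t j" "\<And>i. i \<in> J - {j} \<Longrightarrow> t i \<le> s"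
  shows "0 \<le> poly (pderiv (lagrange_basis J t j)) s"
  unfolding lagrange_basis_def
  using assms by (intro poly_pderiv_prod_nonneg) (auto simp: pderiv_smult pderiv_pCons less_imp_le divide_right_mono)

text \<open>Unit data at the newest level isolate the leading coefficient, and the kernel is
  nonnegative, so only the sign of the interpolant's derivative matters.\<close>

lemma discrete_caputo_unit_nonneg:
  assumes \<alpha>: "\<alpha> < 1" and t: "strict_mono_on {0..n} t"
  shows "0 \<le> discrete_caputo \<alpha> t (\<lambda>m. if m = n then 1 else 0) n"
proof -
  let ?e = "\<lambda>m. if m = n then 1 else 0 :: real"
  have "0 \<le> integral {t (k - 1)..t k}
      (\<lambda>s. (t n - s) powr (- \<alpha>) * poly (pderiv (interp_poly {k - 3..k} t ?e)) s)"
    if k: "k \<in> {1..n}" for k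
  proof -
    have "inj_on t {k - 3..k}"
      using strict_mono_on_imp_inj_on[OF t] by (rule inj_on_subset) (use k in auto)
    then have q: "interp_poly {k - 3..k} t ?e =
        (\<Sum>j\<in>{k - 3..k}. if j = n then lagrange_basis {k - 3..k} t n else 0)"
      by (subst interp_poly_eq) (auto simp del: sum.delta sum.delta' intro!: sum.cong)
    have "0 \<le> poly (pderiv (interp_poly {k - 3..k} t ?e)) s" if s: "s \<in> {t (k - 1)..t k}" for s
    proof (cases "k = n")
      case True
      have "0 \<le> poly (pderiv (lagrange_basis {n - 3..n} t n)) s"
      proof (rule pderiv_lagrange_basis_nonneg)
        fix i assume i: "i \<in> {n - 3..n} - {n}"
        show "t i < t n"
          using i by (intro strict_mono_onD[OF t]) auto
        have "t i \<le> t (n - 1)"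
          using i by (intro strict_mono_on_leD[OF t]) auto
        then show "t i \<le> s" using s True by simp
      qed
      then show ?thesis unfolding q by (simp add: True)
    next
      case False
      \<comment> \<open>Earlier stencils end at \<open>k < n\<close> and see only zero data, so the
        interpolant vanishes.\<close>
      then have "n \<notin> {k - 3..k}" using k by auto
      then show ?thesis by (auto simp: q)
    qed
    \<comment> \<open>A non-integrable integrand would give the default integral 0, so the sign
      needs no integrability proof.\<close>
    then show ?thesis
      by (cases "(\<lambda>s. (t n - s) powr (- \<alpha>) * poly (pderiv (interp_poly {k - 3..k} t ?e)) s)
          integrable_on {t (k - 1)..t k}")
        (auto intro!: integral_nonneg simp: not_integrable_integral)
  qed
  moreover have "0 < Gamma (1 - \<alpha>)" using \<alpha> by (intro Gamma_real_pos) simp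
  ultimately show ?thesis
    unfolding discrete_caputo_def by (intro mult_nonneg_nonneg sum_nonneg) auto
qed

lemma caputo_coeffs_0_nonneg:
  assumes "0 < \<alpha>" "\<alpha> < 1" "strict_mono_on {0..n} t"
  shows "0 \<le> 1 / Gamma (2 - \<alpha>) * caputo_coeffs \<alpha> t n 0"
proof -
  have "(\<Sum>j=0..n. caputo_coeffs \<alpha> t n j * (if n - j = n then 1 else 0)) =
      (\<Sum>j=0..n. if j = 0 then caputo_coeffs \<alpha> t n j else 0)"
    by (intro sum.cong) auto
  then show ?thesis
    using caputo_coeffs_identity[OF assms, of "\<lambda>m. if m = n then 1 else 0"]
      discrete_caputo_unit_nonneg[OF assms(2,3)] by simp
qed

theorem theorem1:
  fixes \<alpha> r T L \<rho> :: real and Kt Kx :: nat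
    and f :: "real \<times> real \<Rightarrow> real" and \<phi> :: "real \<Rightarrow> real"
  assumes "0 < \<alpha>" and "\<alpha> < 1" and "1 \<le> r"
    and "0 < T" and "0 < L" and "0 < \<rho>"
    and "continuous_on ({0..L} \<times> {0..T}) f"
    and "continuous_on {0..L} \<phi>"
    and "0 < Kt" and "0 < Kx"
  shows "\<exists>!u. u \<in> extensional ({0..Kx} \<times> {0..Kt}) \<and> fd_scheme \<alpha> r T L \<rho> Kt Kx f \<phi> u"
proof -
  define t where "t = graded_mesh T Kt r"
  define x where "x i = real i * (L / real Kx)" for i
  define q where "q n j = 1 / Gamma (2 - \<alpha>) * caputo_coeffs \<alpha> t n j" for n j
  define d where "d = \<rho> / (L / real Kx)\<^sup>2"
  have d: "0 < d" using assms by (simp add: d_def)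
  have "strict_mono t"
    unfolding t_def using assms by (intro strict_mono_graded_mesh) auto
  then have q: "0 \<le> q n 0" for n
    unfolding q_def using assms
    by (intro caputo_coeffs_0_nonneg) (auto simp: strict_mono_on_def strict_mono_def)
  \<comment> \<open>The Gamma factor is absorbed into \<open>q\<close> and the mesh width into
    \<open>d\<close>.\<close>
  have scheme: "fd_scheme \<alpha> r T L \<rho> Kt Kx f \<phi> u \<longleftrightarrow>
      (\<forall>i\<in>{1..<Kx}. \<forall>n\<in>{1..Kt}. (\<Sum>j=0..n. q n j * u (i, n - j)) =
        d * (u (i + 1, n) - 2 * u (i, n) + u (i - 1, n)) + f (x i, t n)) \<and>
      (\<forall>n\<in>{1..Kt}. u (0, n) = 0 \<and> u (Kx, n) = 0) \<and> (\<forall>i\<in>{0..Kx}. u (i, 0) = \<phi> (x i))" for u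
    by (simp add: fd_scheme_def Let_def t_def x_def q_def d_def sum_divide_distrib)
  show ?thesis
  proof (rule ex_ex1I)
    let ?X = "{0..Kx} \<times> {0..Kt}"
    obtain u where u: "fd_scheme \<alpha> r T L \<rho> Kt Kx f \<phi> u"
      unfolding scheme
      using implicit_scheme_exists[of Kt q, OF q d \<open>0 < Kx\<close>,
          of "\<lambda>i n. f (x i, t n)" "\<lambda>i. \<phi> (x i)"] by blast
    \<comment> \<open>Restriction is harmless: every index read by the scheme lies on the
      grid.\<close>
    have "(\<Sum>j=0..n. q n j * restrict u ?X (i, n - j)) =
        d * (restrict u ?X (i + 1, n) - 2 * restrict u ?X (i, n) + restrict u ?X (i - 1, n)) +
        f (x i, t n)"
      if "i \<in> {1..<Kx}" "n \<in> {1..Kt}" for i n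
    proof -
      have "(\<Sum>j=0..n. q n j * restrict u ?X (i, n - j)) = (\<Sum>j=0..n. q n j * u (i, n - j))"
        using that by (intro sum.cong refl) auto
      also have "\<dots> = d * (u (i + 1, n) - 2 * u (i, n) + u (i - 1, n)) + f (x i, t n)"
        using that u unfolding scheme by blast
      finally show ?thesis using that by auto
    qed
    then have "fd_scheme \<alpha> r T L \<rho> Kt Kx f \<phi> (restrict u ?X)"
      using u unfolding scheme by (intro conjI ballI) auto
    then show "\<exists>u. u \<in> extensional ?X \<and> fd_scheme \<alpha> r T L \<rho> Kt Kx f \<phi> u"
      by (intro exI[of _ "restrict u ?X"]) simp
  next
    fix u u'
    assume u: "u \<in> extensional ({0..Kx} \<times> {0..Kt}) \<and> fd_scheme \<alpha> r T L \<rho> Kt Kx f \<phi> u"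
      and u': "u' \<in> extensional ({0..Kx} \<times> {0..Kt}) \<and> fd_scheme \<alpha> r T L \<rho> Kt Kx f \<phi> u'"
    note su = conjunct2[OF u, unfolded scheme] and su' = conjunct2[OF u', unfolded scheme]
    show "u = u'"
    \<comment> \<open>Off the grid both functions have the same default value, so only grid points
      need comparison.\<close>
    proof (rule extensionalityI)
      fix y assume "y \<in> {0..Kx} \<times> {0..Kt}"
      then obtain i n where y: "y = (i, n)" "i \<le> Kx" "n \<le> Kt" by auto
      show "u y = u' y"
        unfolding y(1)
        by (rule implicit_scheme_unique[OF q d \<open>0 < Kx\<close>
              conjunct1[OF su] conjunct1[OF conjunct2[OF su]] conjunct2[OF conjunct2[OF su]]
              conjunct1[OF su'] conjunct1[OF conjunct2[OF su']] conjunct2[OF conjunct2[OF su']]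
              y(2,3)])
    qed (use u u' in auto)
  qed
qed

end
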